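(* Let $I$ be a compact interval, let $f\colon I\to I$ be a homeomorphism and let $T\colon I\to\mathbb{R}^+$ be a $C^1$ function. If the suspension of $f$ with return time $T$ is kinematic expansive, then $f$ is the identity map and $T$ is strictly increasing or strictly decreasing.
   Context: Given a homeomorphism $f\colon l\to l$ of a compact metric space and a continuous return time function $T\colon l\to\mathbb{R}^+=(0,\infty)$, the suspension of $f$ with return time $T$ is the flow on the quotient of $\{(x,t):x\in l,\ 0\le t\le T(x)\}$ by $(x,T(x))\sim(f(x),0)$ that moves points along the second coordinate at unit speed. A continuous flow $\phi$ on a compact metric space is kinematic expansive if for all $\epsilon>0$ there exists $\delta>0$ such that if $\operatorname{dist}(\phi_t(x),\phi_t(y))<\delta$ for all $t\in\mathbb{R}$ then there exists $s\in\mathbb{R}$ with $|s|<\epsilon$ and $y=\phi_s(x)$ (this does not depend on the metric inducing the topology). *)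

theory Defs
  imports "HOL-Analysis.Analysis"
begin

section \<open>The suspension space\<close>

definition susp_domain :: "'a set \<Rightarrow> ('a \<Rightarrow> real) \<Rightarrow> ('a \<times> real) set" where
  "susp_domain l T = {(x, t). x \<in> l \<and> 0 \<le> t \<and> t \<le> T x}"

text \<open>The equivalence relation on the domain generated by \<open>(x, T x) \<sim> (f x, 0)\<close>.\<close>

definition susp_rel ::
    "'a set \<Rightarrow> ('a \<Rightarrow> 'a) \<Rightarrow> ('a \<Rightarrow> real) \<Rightarrow> (('a \<times> real) \<times> ('a \<times> real)) set" where
  "susp_rel l f T = {(p, q). p \<in> susp_domain l T \<and> q \<in> susp_domain l T \<and>
     equivclp (\<lambda>p q. \<exists>x\<in>l. p = (x, T x) \<and> q = (f x, 0)) p q}"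

definition susp_space ::
    "'a set \<Rightarrow> ('a \<Rightarrow> 'a) \<Rightarrow> ('a \<Rightarrow> real) \<Rightarrow> ('a \<times> real) set set" where
  "susp_space l f T = susp_domain l T // susp_rel l f T"

definition susp_topology ::
    "'a::topological_space set \<Rightarrow> ('a \<Rightarrow> 'a) \<Rightarrow> ('a \<Rightarrow> real) \<Rightarrow> ('a \<times> real) set topology" where
  "susp_topology l f T = topology (\<lambda>U. U \<subseteq> susp_space l f T \<and>
     openin (top_of_set (susp_domain l T)) {p \<in> susp_domain l T. susp_rel l f T `` {p} \<in> U})"

section \<open>The suspension flow\<close>

text \<open>
  Starting at \<open>(x, s)\<close> and moving for time \<open>t\<close> along the second coordinate, the orbit passes
  through \<open>f x, f (f x), \<dots>\<close> at the successive return times.  After \<open>n\<close> forward crossings it is at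
  \<open>(y, s + t - birkhoff_sum f T n x)\<close> with \<open>y\<close> the \<open>n\<close>-th iterate of \<open>x\<close>; after \<open>n\<close> backward
  crossings it is at \<open>(y, s + t + birkhoff_sum f T n y)\<close> where \<open>x\<close> is the \<open>n\<close>-th iterate of \<open>y\<close>.
  The point reached is the class of those pairs of this form that lie in the domain.
\<close>

definition birkhoff_sum :: "('a \<Rightarrow> 'a) \<Rightarrow> ('a \<Rightarrow> real) \<Rightarrow> nat \<Rightarrow> 'a \<Rightarrow> real" where
  "birkhoff_sum f T n x = (\<Sum>k<n. T ((f ^^ k) x))"

definition susp_move ::
    "('a \<Rightarrow> 'a) \<Rightarrow> ('a \<Rightarrow> real) \<Rightarrow> real \<Rightarrow> 'a \<times> real \<Rightarrow> 'a \<times> real \<Rightarrow> bool" where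
  "susp_move f T t = (\<lambda>(x, s) (y, u). \<exists>n.
     (y = (f ^^ n) x \<and> u = s + t - birkhoff_sum f T n x) \<or>
     (x = (f ^^ n) y \<and> u = s + t + birkhoff_sum f T n y))"

definition susp_flow ::
    "'a set \<Rightarrow> ('a \<Rightarrow> 'a) \<Rightarrow> ('a \<Rightarrow> real) \<Rightarrow> real \<Rightarrow> ('a \<times> real) set \<Rightarrow> ('a \<times> real) set" where
  "susp_flow l f T t P = {q \<in> susp_domain l T. \<exists>p\<in>P. susp_move f T t p q}"

section \<open>Kinematic expansiveness\<close>

definition kinematic_expansive ::
    "'p set \<Rightarrow> ('p \<Rightarrow> 'p \<Rightarrow> real) \<Rightarrow> (real \<Rightarrow> 'p \<Rightarrow> 'p) \<Rightarrow> bool" where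
  "kinematic_expansive M d \<phi> \<longleftrightarrow>
     (\<forall>\<epsilon>>0. \<exists>\<delta>>0. \<forall>x\<in>M. \<forall>y\<in>M. (\<forall>t. d (\<phi> t x) (\<phi> t y) < \<delta>) \<longrightarrow>
        (\<exists>s. \<bar>s\<bar> < \<epsilon> \<and> y = \<phi> s x))"

section \<open>Continuously differentiable functions on a set\<close>

text \<open>
  Derivatives are taken within \<open>S\<close>, hence one-sided at the endpoints of a compact interval; the
  library's \<open>C1_differentiable_on\<close> would constrain the values of the function outside \<open>S\<close>.
\<close>

definition C1_on :: "real set \<Rightarrow> (real \<Rightarrow> real) \<Rightarrow> bool" where
  "C1_on S T \<longleftrightarrow> (\<exists>T'. (\<forall>x\<in>S. (T has_real_derivative T' x) (at x within S)) \<and>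
     continuous_on S T')"

section \<open>Basic facts\<close>

lemma equiv_susp_rel: "equiv (susp_domain l T) (susp_rel l f T)"
proof (rule equivI)
  show "susp_rel l f T \<subseteq> susp_domain l T \<times> susp_domain l T"
    by (auto simp: susp_rel_def)
  show "refl_on (susp_domain l T) (susp_rel l f T)"
    by (auto simp: refl_on_def susp_rel_def)
  show "sym (susp_rel l f T)"
    by (auto simp: sym_def susp_rel_def intro: equivclp_sym)
  show "trans (susp_rel l f T)"
    unfolding trans_def susp_rel_def by (blast intro: equivclp_trans)
qed

lemma openin_susp_topology:
  fixes l :: "'a::topological_space set"
  shows "openin (susp_topology l f T) U \<longleftrightarrow> U \<subseteq> susp_space l f T \<and>
     openin (top_of_set (susp_domain l T)) {p \<in> susp_domain l T. susp_rel l f T `` {p} \<in> U}"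
proof -
  let ?D = "susp_domain l T" and ?R = "susp_rel l f T"
  have Int: "{p \<in> ?D. ?R `` {p} \<in> U \<inter> V} = {p \<in> ?D. ?R `` {p} \<in> U} \<inter> {p \<in> ?D. ?R `` {p} \<in> V}" for U V
    by auto
  have Un: "{p \<in> ?D. ?R `` {p} \<in> \<Union>K} = (\<Union>U\<in>K. {p \<in> ?D. ?R `` {p} \<in> U})" for K
    by auto
  have "istopology (\<lambda>U. U \<subseteq> susp_space l f T \<and>
     openin (top_of_set ?D) {p \<in> ?D. ?R `` {p} \<in> U})"
    unfolding istopology_def Int Un by (auto intro!: openin_Int openin_Union)
  then show ?thesis
    by (simp add: susp_topology_def)
qed

lemma topspace_susp_topology: "topspace (susp_topology l f T) = susp_space l f T"
proof -
  have "{p \<in> susp_domain l T. susp_rel l f T `` {p} \<in> susp_space l f T} = susp_domain l T"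
    by (auto simp: susp_space_def quotientI)
  then have "openin (susp_topology l f T) (susp_space l f T)"
    by (simp add: openin_susp_topology)
  then show ?thesis
    by (meson openin_subset openin_susp_topology openin_topspace subset_antisym)
qed

lemma quotient_map_susp:
  "quotient_map (top_of_set (susp_domain l T)) (susp_topology l f T) (\<lambda>p. susp_rel l f T `` {p})"
  unfolding quotient_map_def topspace_susp_topology openin_susp_topology
  by (auto simp: susp_space_def quotient_def)

text \<open>
  The following facts determine the flow: it preserves the space, is additive in time, and moves
  points within a fibre along the second coordinate.
\<close>

lemma birkhoff_sum_0 [simp]: "birkhoff_sum f T 0 x = 0"
  by (simp add: birkhoff_sum_def)

lemma birkhoff_sum_add:
  "birkhoff_sum f T (m + n) x = birkhoff_sum f T m x + birkhoff_sum f T n ((f ^^ m) x)"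
proof (induction n)
  case (Suc n)
  have "(f ^^ (m + n)) x = (f ^^ n) ((f ^^ m) x)"
    by (simp add: funpow_add add.commute[of m])
  with Suc show ?case
    by (simp add: birkhoff_sum_def)
qed simp

lemma funpow_closed: "f ` l \<subseteq> l \<Longrightarrow> x \<in> l \<Longrightarrow> (f ^^ n) x \<in> l"
  by (induction n) auto

lemma funpow_cancel:
  assumes "inj_on f l" "f ` l \<subseteq> l" "x \<in> l" "y \<in> l" "(f ^^ (m + k)) x = (f ^^ m) y"
  shows "(f ^^ k) x = y"
  using assms(5)
proof (induction m)
  case (Suc m)
  have "(f ^^ (m + k)) x \<in> l" "(f ^^ m) y \<in> l"
    using funpow_closed[OF assms(2)] assms(3,4) by simp_all
  with Suc assms(1) show ?case
    by (simp add: inj_on_eq_iff)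
qed simp

lemma susp_move_sym: "susp_move f T t p q \<Longrightarrow> susp_move f T (- t) q p"
  unfolding susp_move_def by (cases p; cases q) force

lemma susp_move_trans:
  assumes l: "inj_on f l" "f ` l \<subseteq> l" and "fst p \<in> l" "fst q \<in> l" "fst r \<in> l"
    and 1: "susp_move f T s p q" and 2: "susp_move f T t q r"
  shows "susp_move f T (s + t) p r"
proof -
  obtain x a y b z c where pqr: "p = (x, a)" "q = (y, b)" "r = (z, c)"
    by (metis surj_pair)
  have xyz: "x \<in> l" "y \<in> l" "z \<in> l"
    using assms pqr by auto
  let ?S = "birkhoff_sum f T"
  have fwd: "susp_move f T (s + t) p r"
    if "z = (f ^^ n) x" "c = a + s + t - ?S n x" for n
    using that pqr unfolding susp_move_def by auto
  have bwd: "susp_move f T (s + t) p r"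
    if "x = (f ^^ n) z" "c = a + s + t + ?S n z" for n
    using that pqr unfolding susp_move_def by auto
  obtain m n where
    m: "(y = (f ^^ m) x \<and> b = a + s - ?S m x) \<or> (x = (f ^^ m) y \<and> b = a + s + ?S m y)" and
    n: "(z = (f ^^ n) y \<and> c = b + t - ?S n y) \<or> (y = (f ^^ n) z \<and> c = b + t + ?S n z)"
    using 1 2 pqr unfolding susp_move_def by auto
  from m n show ?thesis
  proof (elim disjE conjE)
    assume h: "y = (f ^^ m) x" "b = a + s - ?S m x" "z = (f ^^ n) y" "c = b + t - ?S n y"
    have "z = (f ^^ (m + n)) x"
      using h by (simp add: funpow_add add.commute[of m])
    then show ?thesis
      using h by (intro fwd[of "m + n"]) (auto simp: birkhoff_sum_add)
  next
    assume h: "x = (f ^^ m) y" "b = a + s + ?S m y" "y = (f ^^ n) z" "c = b + t + ?S n z"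
    have "x = (f ^^ (n + m)) z"
      using h by (simp add: funpow_add add.commute[of n])
    then show ?thesis
      using h by (intro bwd[of "n + m"]) (auto simp: birkhoff_sum_add)
  next
    assume h: "y = (f ^^ m) x" "b = a + s - ?S m x" "y = (f ^^ n) z" "c = b + t + ?S n z"
    show ?thesis
    proof (cases "n \<le> m")
      case True
      then obtain k where k: "m = n + k" using le_Suc_ex by blast
      with h have z: "(f ^^ k) x = z"
        using funpow_cancel[OF l, of x z n k] xyz by simp
      have "?S m x = ?S k x + ?S n z"
        using birkhoff_sum_add[of f T k n x] z k by (simp add: add.commute)
      with z h show ?thesis by (intro fwd[of k]) auto
    next
      case False
      then obtain k where k: "n = m + k" using le_Suc_ex nat_le_linear by blast
      with h have z: "(f ^^ k) z = x"
        using funpow_cancel[OF l, of z x m k] xyz by simp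
      have "?S n z = ?S k z + ?S m x"
        using birkhoff_sum_add[of f T k m z] z k by (simp add: add.commute)
      with z h show ?thesis by (intro bwd[of k]) auto
    qed
  next
    assume h: "x = (f ^^ m) y" "b = a + s + ?S m y" "z = (f ^^ n) y" "c = b + t - ?S n y"
    show ?thesis
    proof (cases "n \<le> m")
      case True
      then obtain k where k: "m = n + k" using le_Suc_ex by blast
      have "x = (f ^^ k) z" "?S m y = ?S n y + ?S k z"
        using h k birkhoff_sum_add[of f T n k y] by (simp_all add: funpow_add add.commute[of n])
      with h show ?thesis by (intro bwd[of k]) auto
    next
      case False
      then obtain k where k: "n = m + k" using le_Suc_ex nat_le_linear by blast
      have "z = (f ^^ k) x" "?S n y = ?S m y + ?S k x"
        using h k birkhoff_sum_add[of f T m k y] by (simp_all add: funpow_add add.commute[of m])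
      with h show ?thesis by (intro fwd[of k]) auto
    qed
  qed
qed

lemma birkhoff_sum_pos:
  assumes "f ` l \<subseteq> l" "\<forall>x\<in>l. 0 < T x" "x \<in> l" "0 < n"
  shows "0 < birkhoff_sum f T n x"
  unfolding birkhoff_sum_def using assms funpow_closed[of f l x]
  by (intro sum_pos) auto

lemma susp_move_0_imp_susp_rel:
  assumes f: "f ` l \<subseteq> l" and T: "\<forall>x\<in>l. 0 < T x"
    and D: "(x, s) \<in> susp_domain l T" "(y, u) \<in> susp_domain l T"
    and eq: "y = (f ^^ n) x" "u = s - birkhoff_sum f T n x"
  shows "((x, s), (y, u)) \<in> susp_rel l f T"
proof (cases n)
  case 0
  with D eq show ?thesis by (auto simp: susp_rel_def)
next
  case (Suc m)
  have x: "x \<in> l" "f x \<in> l" "s \<le> T x" "0 \<le> u"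
    using D f by (auto simp: susp_domain_def)
  have S: "birkhoff_sum f T n x = T x + birkhoff_sum f T m (f x)"
    using birkhoff_sum_add[of f T 1 m x] Suc by (simp add: birkhoff_sum_def)
  have "\<not> 0 < m"
    using birkhoff_sum_pos[OF f T x(2)] x eq S by force
  then have "m = 0" by simp
  with x eq S Suc have "s = T x" "u = 0" "y = f x" by auto
  with D x(1) show ?thesis
    unfolding susp_rel_def by auto
qed

lemma susp_move_0_iff:
  assumes f: "inj_on f l" "f ` l \<subseteq> l" and T: "\<forall>x\<in>l. 0 < T x"
    and D: "p \<in> susp_domain l T" "q \<in> susp_domain l T"
  shows "susp_move f T 0 p q \<longleftrightarrow> (p, q) \<in> susp_rel l f T"
proof
  obtain x s y u where pq: "p = (x, s)" "q = (y, u)" by (metis surj_pair)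
  assume "susp_move f T 0 p q"
  then obtain n where "(y = (f ^^ n) x \<and> u = s - birkhoff_sum f T n x) \<or>
     (x = (f ^^ n) y \<and> u = s + birkhoff_sum f T n y)"
    unfolding susp_move_def pq by auto
  then show "(p, q) \<in> susp_rel l f T"
  proof (elim disjE conjE)
    assume "y = (f ^^ n) x" "u = s - birkhoff_sum f T n x"
    with susp_move_0_imp_susp_rel[OF f(2) T] D show ?thesis
      unfolding pq by blast
  next
    assume "x = (f ^^ n) y" "u = s + birkhoff_sum f T n y"
    then have "x = (f ^^ n) y" "s = u - birkhoff_sum f T n y" by simp_all
    with susp_move_0_imp_susp_rel[OF f(2) T] D have "(q, p) \<in> susp_rel l f T"
      unfolding pq by blast
    then show ?thesis
      using equiv_susp_rel by (meson equivE symD)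
  qed
next
  assume "(p, q) \<in> susp_rel l f T"
  then have "(symclp (\<lambda>p q. \<exists>x\<in>l. p = (x, T x) \<and> q = (f x, 0)))\<^sup>*\<^sup>* p q"
    by (simp add: susp_rel_def equivclp_def)
  then have "fst q \<in> l \<and> susp_move f T 0 p q"
  proof (induction rule: rtranclp_induct)
    case base
    have "susp_move f T 0 p p"
      unfolding susp_move_def by (auto intro: exI[of _ 0])
    with D show ?case by (auto simp: susp_domain_def)
  next
    case (step q r)
    have gen: "susp_move f T 0 (x, T x) (f x, 0)" for x
      unfolding susp_move_def by (auto intro: exI[of _ 1] simp: birkhoff_sum_def)
    from step(2) have "fst r \<in> l \<and> susp_move f T 0 q r"
      using gen susp_move_sym[OF gen] f(2) by (auto simp: symclp_def)
    with step susp_move_trans[OF f, of p q r T 0 0] D show ?case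
      by (auto simp: susp_domain_def)
  qed
  then show "susp_move f T 0 p q" by simp
qed

lemma susp_flow_class:
  assumes f: "inj_on f l" "f ` l \<subseteq> l" and T: "\<forall>x\<in>l. 0 < T x"
    and D: "p \<in> susp_domain l T" "q \<in> susp_domain l T" and "susp_move f T t p q"
  shows "susp_flow l f T t (susp_rel l f T `` {p}) = susp_rel l f T `` {q}"
proof -
  have R: "susp_rel l f T \<subseteq> susp_domain l T \<times> susp_domain l T"
    by (auto simp: susp_rel_def)
  have fst: "fst r \<in> l" if "r \<in> susp_domain l T" for r
    using that by (auto simp: susp_domain_def)
  note tr = susp_move_trans[OF f fst fst fst]
  note iff = susp_move_0_iff[OF f T]
  have "susp_move f T 0 q r" if "(p, p') \<in> susp_rel l f T" "r \<in> susp_domain l T"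
    "susp_move f T t p' r" for p' r
  proof -
    have p': "p' \<in> susp_domain l T" using that R by auto
    then have "susp_move f T 0 p p'" using that iff D by blast
    then have "susp_move f T t p r" using tr[OF D(1) p' that(2) _ that(3), of 0] by simp
    then show ?thesis
      using tr[OF D(2,1) that(2) susp_move_sym[OF assms(6)], of t] by simp
  qed
  moreover have "susp_move f T t p r" if "(q, r) \<in> susp_rel l f T" for r
  proof -
    have r: "r \<in> susp_domain l T" using that R by auto
    then have "susp_move f T 0 q r" using that iff D by blast
    then show ?thesis using tr[OF D r assms(6), of 0] by simp
  qed
  moreover have "(p, p) \<in> susp_rel l f T"
    using D by (auto simp: susp_rel_def)
  ultimately show ?thesis
    using R iff[OF D(2)] unfolding susp_flow_def by blast
qed

lemma susp_flow_within_fibre: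
  assumes f: "inj_on f l" "f ` l \<subseteq> l" and T: "\<forall>x\<in>l. 0 < T x"
    and "x \<in> l" "0 \<le> s" "s \<le> T x" "0 \<le> s + t" "s + t \<le> T x"
  shows "susp_flow l f T t (susp_rel l f T `` {(x, s)}) = susp_rel l f T `` {(x, s + t)}"
  by (rule susp_flow_class[OF f T])
    (use assms in \<open>auto simp: susp_domain_def susp_move_def intro: exI[of _ 0]\<close>)

lemma susp_move_exists:
  fixes l :: "'a::topological_space set"
  assumes l: "compact l" and f: "bij_betw f l l"
    and T: "continuous_on l T" "\<forall>x\<in>l. 0 < T x" and p: "fst p \<in> l"
  shows "\<exists>q\<in>susp_domain l T. susp_move f T t p q"
proof -
  have f': "inj_on f l" "f ` l \<subseteq> l" "f ` l = l"
    using f by (auto simp: bij_betw_def)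
  obtain x0 where x0: "x0 \<in> l" "\<And>x. x \<in> l \<Longrightarrow> T x0 \<le> T x"
    using continuous_attains_inf[OF l _ T(1)] p by auto
  define c where "c = T x0"
  have c: "0 < c" "\<And>x. x \<in> l \<Longrightarrow> c \<le> T x"
    using x0 T by (auto simp: c_def)
  have step: "\<exists>q\<in>susp_domain l T. susp_move f T 0 (x, v) q"
    if "x \<in> l" "\<bar>v\<bar> \<le> of_nat k * c" for x v k
    using that
  proof (induction k arbitrary: x v)
    case 0
    then show ?case using c T by (intro bexI[of _ "(x, 0)"])
        (auto simp: susp_domain_def susp_move_def less_imp_le intro: exI[of _ 0])
  next
    case (Suc k)
    consider "0 \<le> v" "v \<le> T x" | "T x < v" | "v < 0" by linarith
    then show ?case
    proof cases
      case 1
      with Suc show ?thesis by (intro bexI[of _ "(x, v)"])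
        (auto simp: susp_domain_def susp_move_def intro: exI[of _ 0])
    next
      case 2
      have "\<bar>v - T x\<bar> \<le> of_nat k * c" "f x \<in> l"
        using 2 Suc.prems c(2)[of x] f' by (auto simp: algebra_simps)
      then obtain q where q: "q \<in> susp_domain l T" "susp_move f T 0 (f x, v - T x) q"
        using Suc.IH by blast
      have "susp_move f T 0 (x, v) (f x, v - T x)"
        unfolding susp_move_def by (auto intro: exI[of _ 1] simp: birkhoff_sum_def)
      moreover have "fst q \<in> l" using q by (auto simp: susp_domain_def)
      ultimately have "susp_move f T 0 (x, v) q"
        using susp_move_trans[OF f'(1,2), of "(x, v)" "(f x, v - T x)" q T 0 0]
          q Suc.prems \<open>f x \<in> l\<close> by simp
      with q show ?thesis by blast
    next
      case 3
      obtain y where y: "y \<in> l" "x = f y" using f' Suc.prems by blast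
      have mv: "susp_move f T 0 (x, v) (y, v + T y)"
        unfolding susp_move_def using y by (auto intro!: exI[of _ 1] simp: birkhoff_sum_def)
      show ?thesis
      proof (cases "v + T y \<ge> 0")
        case True
        with 3 y mv show ?thesis
          by (intro bexI[of _ "(y, v + T y)"]) (auto simp: susp_domain_def)
      next
        case False
        then have "\<bar>v + T y\<bar> \<le> of_nat k * c"
          using 3 Suc.prems c(2)[of y] y by (auto simp: algebra_simps)
        then obtain q where q: "q \<in> susp_domain l T" "susp_move f T 0 (y, v + T y) q"
          using Suc.IH y by blast
        moreover have "fst q \<in> l" using q by (auto simp: susp_domain_def)
        ultimately have "susp_move f T 0 (x, v) q"
          using susp_move_trans[OF f'(1,2), of "(x, v)" "(y, v + T y)" q T 0 0]
            mv Suc.prems y by simp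
        with q show ?thesis by blast
      qed
    qed
  qed
  obtain x s where xs: "p = (x, s)" by (metis surj_pair)
  obtain k where "\<bar>s + t\<bar> / c \<le> of_nat k"
    using real_arch_simple by blast
  then have "\<bar>s + t\<bar> \<le> of_nat k * c"
    using c by (simp add: divide_simps)
  with step p xs obtain q where "q \<in> susp_domain l T" "susp_move f T 0 (x, s + t) q"
    by fastforce
  then show ?thesis
    using xs by (intro bexI[of _ q]) (auto simp: susp_move_def)
qed

lemma susp_flow_in_susp_space:
  fixes l :: "'a::topological_space set"
  assumes l: "compact l" and f: "bij_betw f l l"
    and T: "continuous_on l T" "\<forall>x\<in>l. 0 < T x" and "P \<in> susp_space l f T"
  shows "susp_flow l f T t P \<in> susp_space l f T"
proof -
  have f': "inj_on f l" "f ` l \<subseteq> l"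
    using f by (auto simp: bij_betw_def)
  obtain p where p: "p \<in> susp_domain l T" "P = susp_rel l f T `` {p}"
    using assms(5) by (auto simp: susp_space_def quotient_def)
  then obtain q where "q \<in> susp_domain l T" "susp_move f T t p q"
    using susp_move_exists[OF l f T, of p t] by (auto simp: susp_domain_def)
  with susp_flow_class[OF f' T(2)] p show ?thesis
    by (auto simp: susp_space_def quotientI)
qed

lemma susp_flow_0:
  assumes f: "inj_on f l" "f ` l \<subseteq> l" and T: "\<forall>x\<in>l. 0 < T x"
    and "P \<in> susp_space l f T"
  shows "susp_flow l f T 0 P = P"
proof -
  obtain p where p: "p \<in> susp_domain l T" "P = susp_rel l f T `` {p}"
    using assms(4) by (auto simp: susp_space_def quotient_def)
  moreover have "(p, p) \<in> susp_rel l f T"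
    using p by (auto simp: susp_rel_def)
  ultimately show ?thesis
    using susp_flow_class[OF f T p(1) p(1)] susp_move_0_iff[OF f T p(1) p(1)] by simp
qed

lemma susp_flow_add:
  fixes l :: "'a::topological_space set"
  assumes l: "compact l" and f: "bij_betw f l l"
    and T: "continuous_on l T" "\<forall>x\<in>l. 0 < T x" and "P \<in> susp_space l f T"
  shows "susp_flow l f T (s + t) P = susp_flow l f T t (susp_flow l f T s P)"
proof -
  have f': "inj_on f l" "f ` l \<subseteq> l"
    using f by (auto simp: bij_betw_def)
  have fst: "fst r \<in> l" if "r \<in> susp_domain l T" for r
    using that by (auto simp: susp_domain_def)
  obtain p where p: "p \<in> susp_domain l T" "P = susp_rel l f T `` {p}"
    using assms(5) by (auto simp: susp_space_def quotient_def)
  obtain q where q: "q \<in> susp_domain l T" "susp_move f T s p q"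
    using susp_move_exists[OF l f T fst[OF p(1)]] by blast
  obtain r where r: "r \<in> susp_domain l T" "susp_move f T t q r"
    using susp_move_exists[OF l f T fst[OF q(1)]] by blast
  have "susp_move f T (s + t) p r"
    using susp_move_trans[OF f' fst fst fst] p q r by blast
  then show ?thesis
    using susp_flow_class[OF f' T(2)] p q r by simp
qed

end

theory Submission
  imports Defs
begin

text \<open>
  Two points of \<open>l \<times> {0}\<close> whose \<open>f\<close>-orbits and Birkhoff sums stay close in both time directions
  have close flow orbits at all times, so expansivity forces them to be equal.  On an interval this
  has three consequences.  If \<open>f \<circ> f\<close> moved a point, the points near it would contradict this,
  because wandering intervals have summable lengths.  Hence \<open>f\<close> is an involution, and a decreasing
  one would give the contradicting pairs \<open>x, f x\<close> near its fixed point.  Finally, if \<open>f\<close> is the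
  identity, then nearby points with equal return times coincide, so the continuous function \<open>T\<close> is
  locally injective, hence strictly monotone.
\<close>

section \<open>Shadowing in suspensions\<close>

text \<open>Rescaling the heights of the compact product of \<open>l\<close> and
  \<open>{0..1}\<close> by \<open>T\<close> gives exactly the domain; dividing by the positive
  \<open>T x\<close> recovers the parameter.\<close>

lemma compact_susp_domain:
  fixes l :: "'a::metric_space set"
  assumes "compact l" "continuous_on l T" "\<forall>x\<in>l. 0 < T x"
  shows "compact (susp_domain l T)"
proof -
  have "susp_domain l T = (\<lambda>(x, s). (x, s * T x)) ` (l \<times> {0..1})"
  proof (intro equalityI subsetI)
    fix p assume "p \<in> susp_domain l T"
    then obtain x t where p: "p = (x, t)" "x \<in> l" "0 \<le> t" "t \<le> T x"
      by (auto simp: susp_domain_def)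
    with assms have "p = (\<lambda>(x, s). (x, s * T x)) (x, t / T x)" "t / T x \<in> {0..1}"
      by auto
    with p show "p \<in> (\<lambda>(x, s). (x, s * T x)) ` (l \<times> {0..1})"
      by blast
  next
    fix p assume "p \<in> (\<lambda>(x, s). (x, s * T x)) ` (l \<times> {0..1})"
    then show "p \<in> susp_domain l T"
      using assms by (auto simp: susp_domain_def mult_left_le_one_le less_imp_le)
  qed
  moreover have "compact ((\<lambda>(x, s). (x, s * T x)) ` (l \<times> {0..1::real}))"
    using assms unfolding case_prod_beta
    by (intro compact_continuous_image compact_Times continuous_intros
        continuous_on_compose2[OF assms(2)]) auto
  ultimately show ?thesis by simp
qed

section \<open>Suspensions with a compatible metric\<close>

locale metrized_suspension =
  fixes l :: "'a::metric_space set" and f g :: "'a \<Rightarrow> 'a" and T :: "'a \<Rightarrow> real"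
    and d :: "('a \<times> real) set \<Rightarrow> ('a \<times> real) set \<Rightarrow> real"
  assumes l: "compact l" and homeo: "homeomorphism l l f g"
    and Tc: "continuous_on l T" and Tpos: "\<forall>x\<in>l. 0 < T x"
    and d: "Metric_space (susp_space l f T) d"
    and top: "Metric_space.mtopology (susp_space l f T) d = susp_topology l f T"
begin

abbreviation "D \<equiv> susp_domain l T"

abbreviation cls :: "'a \<times> real \<Rightarrow> ('a \<times> real) set" where
  "cls p \<equiv> susp_rel l f T `` {p}"

lemma f_simps: "inj_on f l" "f ` l \<subseteq> l"
  and g_in: "x \<in> l \<Longrightarrow> g x \<in> l" and f_in: "x \<in> l \<Longrightarrow> f x \<in> l"
  and f_g: "x \<in> l \<Longrightarrow> f (g x) = x" and g_f: "x \<in> l \<Longrightarrow> g (f x) = x"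
  using homeo by (auto simp: homeomorphism_def inj_on_def) metis

lemma funpow_in: "x \<in> l \<Longrightarrow> (f ^^ n) x \<in> l" "x \<in> l \<Longrightarrow> (g ^^ n) x \<in> l"
  by (induction n) (auto simp: f_in g_in)

lemma funpow_f_g: "x \<in> l \<Longrightarrow> (f ^^ n) ((g ^^ n) x) = x"
proof (induction n)
  case (Suc n)
  then have "(f ^^ n) (f (g ((g ^^ n) x))) = x"
    using funpow_in f_g by simp
  then show ?case by (simp add: funpow_swap1)
qed simp

lemma funpow_g_f: "x \<in> l \<Longrightarrow> (g ^^ n) ((f ^^ n) x) = x"
proof (induction n)
  case (Suc n)
  then have "(g ^^ n) (g (f ((f ^^ n) x))) = x"
    using funpow_in g_f by simp
  then show ?case by (simp add: funpow_swap1)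
qed simp

text \<open>The class map is continuous on a compact metric space, hence uniformly continuous for
  any metric \<open>d\<close> inducing the quotient topology. Closeness in the domain thus passes to
  the quotient uniformly.\<close>

lemma dist_cls_less:
  assumes "0 < e"
  obtains \<eta> where "0 < \<eta>" "\<And>p q. p \<in> D \<Longrightarrow> q \<in> D \<Longrightarrow> dist p q < \<eta> \<Longrightarrow> d (cls p) (cls q) < e"
proof -
  interpret M: Metric_space "susp_space l f T" d by (rule d)
  let ?m1 = "submetric euclidean_metric D :: ('a \<times> real) metric"
  let ?m2 = "metric (susp_space l f T, d)"
  have "continuous_map (top_of_set D) (susp_topology l f T) cls"
    using quotient_imp_continuous_map[OF quotient_map_susp] .
  then have "continuous_map (mtopology_of ?m1) (mtopology_of ?m2) cls"
    by (simp add: mtopology_of_submetric top)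
  moreover have "compact_space (mtopology_of ?m1)"
    using compact_susp_domain[OF l Tc Tpos]
    by (simp add: mtopology_of_submetric compact_space_subtopology)
  ultimately have "uniformly_continuous_map ?m1 ?m2 cls"
    using continuous_eq_uniformly_continuous_map by blast
  then obtain \<eta> where "0 < \<eta>" "\<forall>x\<in>D. \<forall>y\<in>D. dist y x < \<eta> \<longrightarrow> d (cls y) (cls x) < e"
    using assms unfolding uniformly_continuous_map_def by auto
  then show thesis using that by blast
qed

lemma T_lower_bound: obtains m where "0 < m" "\<And>x. x \<in> l \<Longrightarrow> m \<le> T x"
proof (cases "l = {}")
  case False
  then obtain x0 where "x0 \<in> l" "\<And>x. x \<in> l \<Longrightarrow> T x0 \<le> T x"
    using continuous_attains_inf[OF l _ Tc] by auto
  with Tpos that show thesis by blast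
qed (use that[of 1] in auto)

lemma T_uniform:
  assumes "0 < e"
  obtains \<eta> where "0 < \<eta>" "\<And>x y. x \<in> l \<Longrightarrow> y \<in> l \<Longrightarrow> dist x y < \<eta> \<Longrightarrow> \<bar>T x - T y\<bar> < e"
  using compact_uniformly_continuous[OF Tc l] assms
  unfolding uniformly_continuous_on_def dist_real_def by metis

lemma cls_crossing: "x \<in> l \<Longrightarrow> cls (x, T x) = cls (f x, 0)"
proof -
  assume x: "x \<in> l"
  then have "(x, T x) \<in> D" "(f x, 0) \<in> D"
    using f_in Tpos by (auto simp: susp_domain_def less_imp_le)
  with x have "((x, T x), (f x, 0)) \<in> susp_rel l f T"
    unfolding susp_rel_def by auto
  then show ?thesis
    by (rule equiv_class_eq[OF equiv_susp_rel])
qed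

lemma move_crossing: "susp_move f T 0 (x, w) (f x, w - T x)"
  unfolding susp_move_def by (auto intro: exI[of _ 1] simp: birkhoff_sum_def)

text \<open>A height slightly outside \<open>{0..T y}\<close> is moved into the neighbouring fibre; there the
  distance estimate goes through the gluing point between the two fibres.\<close>

lemma dist_cls_near:
  assumes "0 < e"
  obtains \<eta> where "0 < \<eta>"
    "\<And>x v y w. (x, v) \<in> D \<Longrightarrow> y \<in> l \<Longrightarrow> dist x y < \<eta> \<Longrightarrow> \<bar>v - w\<bar> < \<eta> \<Longrightarrow>
       \<exists>q\<in>D. susp_move f T 0 (y, w) q \<and> d (cls (x, v)) (cls q) < e"
proof -
  interpret M: Metric_space "susp_space l f T" d by (rule d)
  obtain \<eta>1 where \<eta>1: "0 < \<eta>1"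
    "\<And>p q. p \<in> D \<Longrightarrow> q \<in> D \<Longrightarrow> dist p q < \<eta>1 \<Longrightarrow> d (cls p) (cls q) < e / 2"
    using dist_cls_less[of "e / 2"] assms by auto
  obtain m where m: "0 < m" "\<And>x. x \<in> l \<Longrightarrow> m \<le> T x" using T_lower_bound by metis
  \<comment> \<open>The bound \<open>r \<le> m\<close> lets a height that leaves its fibre by at
    most \<open>r\<close> cross only one gluing point; the factor 1/4 keeps base distance plus
    height distance below \<open>\<eta>1\<close>.\<close>
  define r where "r = min m (\<eta>1 / 4)"
  have r: "0 < r" "r \<le> m" "4 * r \<le> \<eta>1" using m \<eta>1 by (auto simp: r_def)
  obtain \<eta>2 where \<eta>2: "0 < \<eta>2" "\<And>x y. x \<in> l \<Longrightarrow> y \<in> l \<Longrightarrow> dist x y < \<eta>2 \<Longrightarrow> \<bar>T x - T y\<bar> < r / 2"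
    using T_uniform[of "r / 2"] r by auto
  define \<eta> where "\<eta> = min \<eta>2 (r / 2)"
  have \<eta>: "0 < \<eta>" "\<eta> \<le> \<eta>2" "\<eta> \<le> r / 2" using r \<eta>2 by (auto simp: \<eta>_def)
  have close: "d (cls (x, v)) (cls (y, w)) < e / 2"
    if "(x, v) \<in> D" "(y, w) \<in> D" "dist x y < \<eta>" "\<bar>v - w\<bar> < r" for x v y w
  proof (rule \<eta>1(2)[OF that(1,2)])
    have "dist (x, v) (y, w) \<le> dist x y + dist v w"
      unfolding dist_Pair_Pair by (intro sqrt_sum_squares_le_sum) auto
    also have "\<dots> < \<eta>1" using that \<eta> r by (simp add: dist_real_def)
    finally show "dist (x, v) (y, w) < \<eta>1" .
  qed
  have mem: "cls p \<in> susp_space l f T" if "p \<in> D" for p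
    using that by (simp add: susp_space_def quotientI)
  have tri: "d (cls p) (cls q) < e"
    if "p \<in> D" "q \<in> D" "p' \<in> D" "q' \<in> D" "d (cls p) (cls p') < e / 2" "d (cls q') (cls q) < e / 2"
      "cls p' = cls q'" for p p' q q'
    using M.triangle[of "cls p" "cls p'" "cls q"] mem that by simp
  show thesis
  proof (rule that[OF \<eta>(1)])
    fix x v y w
    assume a: "(x, v) \<in> D" "y \<in> l" "dist x y < \<eta>" "\<bar>v - w\<bar> < \<eta>"
    have xv: "x \<in> l" "0 \<le> v" "v \<le> T x" using a by (auto simp: susp_domain_def)
    have Txy: "\<bar>T x - T y\<bar> < r / 2" using \<eta>2(2) a xv \<eta> by simp
    consider "0 \<le> w" "w \<le> T y" | "w < 0" | "T y < w" by linarith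
    then show "\<exists>q\<in>D. susp_move f T 0 (y, w) q \<and> d (cls (x, v)) (cls q) < e"
    proof cases
      case 1
      then have "(y, w) \<in> D" using a by (auto simp: susp_domain_def)
      with close[of x v y w] a \<eta> r assms show ?thesis
        by (intro bexI[of _ "(y, w)"]) (auto simp: susp_move_def intro: exI[of _ 0])
    next
      case 2
      have gy: "g y \<in> l" "f (g y) = y" using a g_in f_g by auto
      have Tg: "m \<le> T (g y)" using gy m by auto
      \<comment> \<open>The undershoot is less than \<open>\<eta>\<close>, which is below the
        minimal return time, so one backward crossing suffices.\<close>
      have "- w \<le> T (g y)" using 2 a xv \<eta> r Tg by auto
      then have D: "(g y, T (g y) + w) \<in> D" "(y, 0) \<in> D" "(g y, T (g y)) \<in> D"
        using 2 a gy Tpos by (auto simp: susp_domain_def less_imp_le)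
      have "susp_move f T (- 0) (y, w) (g y, T (g y) + w)"
        using move_crossing[of "g y" "T (g y) + w"] gy by (intro susp_move_sym) simp
      moreover have "d (cls (x, v)) (cls (y, 0)) < e / 2"
        using 2 a xv \<eta> r D by (intro close) auto
      moreover have "d (cls (g y, T (g y))) (cls (g y, T (g y) + w)) < e / 2"
        using 2 a xv \<eta> r D by (intro close) auto
      moreover have "cls (y, 0) = cls (g y, T (g y))"
        using cls_crossing[OF gy(1)] gy by simp
      ultimately show ?thesis
        using tri[OF a(1) D(1) D(2) D(3)] D by (intro bexI[of _ "(g y, T (g y) + w)"]) auto
    next
      case 3
      have fy: "f y \<in> l" "m \<le> T (f y)" using a f_in m by auto
      \<comment> \<open>Here \<open>v \<le> T x\<close>, and \<open>T x\<close> differs from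
        \<open>T y\<close> by less than \<open>r / 2\<close>; so \<open>w > T y\<close> within
        \<open>\<eta>\<close> of \<open>v\<close> forces both heights to lie within \<open>r\<close>
        of \<open>T y\<close>.\<close>
      have le: "w - T y \<le> T (f y)"
        using a(4) \<eta>(3) r(2) xv(3) Txy fy(2) by linarith
      have D: "(f y, w - T y) \<in> D" "(y, T y) \<in> D" "(f y, 0) \<in> D"
        using 3 a fy le Tpos by (auto simp: susp_domain_def less_imp_le)
      have "\<bar>v - T y\<bar> < r"
        using 3 a(4) \<eta>(3) r(1) xv(3) Txy by linarith
      with a D have "d (cls (x, v)) (cls (y, T y)) < e / 2"
        by (intro close) auto
      moreover have "d (cls (f y, 0)) (cls (f y, w - T y)) < e / 2"
      proof (intro close)
        show "\<bar>0 - (w - T y)\<bar> < r"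
          using 3 a(4) \<eta>(3) r(1) xv(3) Txy by linarith
      qed (use D \<eta>(1) in auto)
      ultimately show ?thesis
        using tri[OF a(1) D(1) D(2) D(3)] D cls_crossing[OF a(2)] move_crossing
        by (intro bexI[of _ "(f y, w - T y)"]) auto
    qed
  qed
qed

text \<open>Moving from \<open>(x, 0)\<close> for time \<open>t\<close> amounts to some number
  \<open>n\<close> of crossings. The same number of crossings from \<open>(y, 0)\<close> gives a
  pair whose base point and height are off by less than \<open>\<eta>\<close>, and
  \<open>dist_cls_near\<close> corrects a height outside its fibre.\<close>

lemma shadowing:
  assumes "0 < e"
  obtains \<eta> where "0 < \<eta>"
    "\<And>x y t. \<lbrakk>x \<in> l; y \<in> l;
       \<And>n. dist ((f ^^ n) x) ((f ^^ n) y) < \<eta>; \<And>n. dist ((g ^^ n) x) ((g ^^ n) y) < \<eta>;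
       \<And>n. \<bar>birkhoff_sum f T n x - birkhoff_sum f T n y\<bar> < \<eta>;
       \<And>n. \<bar>birkhoff_sum f T n ((g ^^ n) x) - birkhoff_sum f T n ((g ^^ n) y)\<bar> < \<eta>\<rbrakk> \<Longrightarrow>
       d (susp_flow l f T t (cls (x, 0))) (susp_flow l f T t (cls (y, 0))) < e"
proof -
  obtain \<eta> where \<eta>: "0 < \<eta>"
    "\<And>x v y w. (x, v) \<in> D \<Longrightarrow> y \<in> l \<Longrightarrow> dist x y < \<eta> \<Longrightarrow> \<bar>v - w\<bar> < \<eta> \<Longrightarrow>
       \<exists>q\<in>D. susp_move f T 0 (y, w) q \<and> d (cls (x, v)) (cls q) < e"
    using dist_cls_near[OF assms] by metis
  show thesis
  proof (rule that[OF \<eta>(1)])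
    fix x y t
    assume xy: "x \<in> l" "y \<in> l"
      and F: "\<And>n. dist ((f ^^ n) x) ((f ^^ n) y) < \<eta>" and G: "\<And>n. dist ((g ^^ n) x) ((g ^^ n) y) < \<eta>"
      and SF: "\<And>n. \<bar>birkhoff_sum f T n x - birkhoff_sum f T n y\<bar> < \<eta>"
      and SG: "\<And>n. \<bar>birkhoff_sum f T n ((g ^^ n) x) - birkhoff_sum f T n ((g ^^ n) y)\<bar> < \<eta>"
    have D0: "(x, 0) \<in> D" "(y, 0) \<in> D"
      using xy Tpos by (auto simp: susp_domain_def less_imp_le)
    have "bij_betw f l l"
      using homeo f_simps by (auto simp: bij_betw_def homeomorphism_def)
    then obtain x' v where p: "(x', v) \<in> D" "susp_move f T t (x, 0) (x', v)"
      using susp_move_exists[OF l _ Tc Tpos, of f "(x, 0)" t] xy by auto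
    have x': "x' \<in> l" using p by (auto simp: susp_domain_def)
    have "\<exists>y' w. y' \<in> l \<and> dist x' y' < \<eta> \<and> \<bar>v - w\<bar> < \<eta> \<and> susp_move f T t (y, 0) (y', w)"
    proof -
      obtain n where "(x' = (f ^^ n) x \<and> v = t - birkhoff_sum f T n x) \<or>
          (x = (f ^^ n) x' \<and> v = t + birkhoff_sum f T n x')"
        using p(2) by (auto simp: susp_move_def)
      then show ?thesis
      proof (elim disjE conjE)
        assume h: "x' = (f ^^ n) x" "v = t - birkhoff_sum f T n x"
        have "susp_move f T t (y, 0) ((f ^^ n) y, t - birkhoff_sum f T n y)"
          unfolding susp_move_def by auto
        then show ?thesis
          using h F[of n] SF[of n] funpow_in xy
          by (intro exI[of _ "(f ^^ n) y"] exI[of _ "t - birkhoff_sum f T n y"]) auto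
      next
        assume h: "x = (f ^^ n) x'" "v = t + birkhoff_sum f T n x'"
        then have gx: "x' = (g ^^ n) x" using funpow_g_f[OF x'] by simp
        have "susp_move f T t (y, 0) ((g ^^ n) y, t + birkhoff_sum f T n ((g ^^ n) y))"
          unfolding susp_move_def using funpow_f_g[OF xy(2)] by auto metis
        then show ?thesis
          using h gx G[of n] SG[of n] funpow_in xy
          by (intro exI[of _ "(g ^^ n) y"] exI[of _ "t + birkhoff_sum f T n ((g ^^ n) y)"]) auto
      qed
    qed
    then obtain y' w where y': "y' \<in> l" "dist x' y' < \<eta>" "\<bar>v - w\<bar> < \<eta>"
      "susp_move f T t (y, 0) (y', w)" by blast
    then obtain q where q: "q \<in> D" "susp_move f T 0 (y', w) q" "d (cls (x', v)) (cls q) < e"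
      using \<eta>(2)[OF p(1)] by blast
    have "fst q \<in> l" using q by (auto simp: susp_domain_def)
    then have "susp_move f T (t + 0) (y, 0) q"
      using susp_move_trans[OF f_simps, of "(y, 0)" "(y', w)" q T t 0] y' q xy by simp
    then have "susp_flow l f T t (cls (y, 0)) = cls q"
      using susp_flow_class[OF f_simps Tpos D0(2) q(1)] by simp
    moreover have "susp_flow l f T t (cls (x, 0)) = cls (x', v)"
      using susp_flow_class[OF f_simps Tpos D0(1) p(1,2)] .
    ultimately show "d (susp_flow l f T t (cls (x, 0))) (susp_flow l f T t (cls (y, 0))) < e"
      using q by simp
  qed
qed

text \<open>Moving from one point of \<open>l \<times> {0}\<close> to another one takes at least the minimal return time,
  so below that time the expansivity conclusion degenerates to equality.\<close>

lemma kinematic_expansive_imp_eq: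
  assumes "kinematic_expansive (susp_space l f T) d (susp_flow l f T)"
  obtains \<eta> where "0 < \<eta>"
    "\<And>x y. \<lbrakk>x \<in> l; y \<in> l;
       \<And>n. dist ((f ^^ n) x) ((f ^^ n) y) < \<eta>; \<And>n. dist ((g ^^ n) x) ((g ^^ n) y) < \<eta>;
       \<And>n. \<bar>birkhoff_sum f T n x - birkhoff_sum f T n y\<bar> < \<eta>;
       \<And>n. \<bar>birkhoff_sum f T n ((g ^^ n) x) - birkhoff_sum f T n ((g ^^ n) y)\<bar> < \<eta>\<rbrakk> \<Longrightarrow>
       x = y"
proof -
  obtain m where m: "0 < m" "\<And>x. x \<in> l \<Longrightarrow> m \<le> T x" using T_lower_bound by metis
  \<comment> \<open>Any positive number of crossings between points at height 0 takes at least the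
    time \<open>m\<close>.\<close>
  have S: "m \<le> birkhoff_sum f T n x" if x: "x \<in> l" and n: "n \<noteq> 0" for n x
  proof -
    obtain k where "n = Suc k" using n by (cases n) auto
    moreover have "0 \<le> birkhoff_sum f T k (f x)"
      unfolding birkhoff_sum_def
    proof (rule sum_nonneg)
      fix i
      have "(f ^^ i) (f x) \<in> l" by (rule funpow_in(1)[OF f_in[OF x]])
      then show "0 \<le> T ((f ^^ i) (f x))" using m by fastforce
    qed
    moreover have "birkhoff_sum f T (1 + k) x = T x + birkhoff_sum f T k (f x)"
      unfolding birkhoff_sum_add by (simp add: birkhoff_sum_def)
    ultimately show ?thesis
      using m(2)[OF x] by simp
  qed
  \<comment> \<open>The expansivity tolerance is \<open>m\<close> itself, so the resulting time
    shift \<open>s\<close> is too short for a crossing.\<close>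
  obtain e where e: "0 < e" "\<And>P Q. P \<in> susp_space l f T \<Longrightarrow> Q \<in> susp_space l f T \<Longrightarrow>
      \<forall>t. d (susp_flow l f T t P) (susp_flow l f T t Q) < e \<Longrightarrow>
      \<exists>s. \<bar>s\<bar> < m \<and> Q = susp_flow l f T s P"
    using assms[unfolded kinematic_expansive_def, rule_format, OF m(1)] by (elim exE conjE) blast
  obtain \<eta> where \<eta>: "0 < \<eta>"
    "\<And>x y t. \<lbrakk>x \<in> l; y \<in> l;
       \<And>n. dist ((f ^^ n) x) ((f ^^ n) y) < \<eta>; \<And>n. dist ((g ^^ n) x) ((g ^^ n) y) < \<eta>;
       \<And>n. \<bar>birkhoff_sum f T n x - birkhoff_sum f T n y\<bar> < \<eta>;
       \<And>n. \<bar>birkhoff_sum f T n ((g ^^ n) x) - birkhoff_sum f T n ((g ^^ n) y)\<bar> < \<eta>\<rbrakk> \<Longrightarrow>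
       d (susp_flow l f T t (cls (x, 0))) (susp_flow l f T t (cls (y, 0))) < e"
    using shadowing[OF e(1)] by metis
  show thesis
  proof (rule that[OF \<eta>(1)])
    fix x y
    assume xy: "x \<in> l" "y \<in> l"
      and "\<And>n. dist ((f ^^ n) x) ((f ^^ n) y) < \<eta>" "\<And>n. dist ((g ^^ n) x) ((g ^^ n) y) < \<eta>"
       "\<And>n. \<bar>birkhoff_sum f T n x - birkhoff_sum f T n y\<bar> < \<eta>"
       "\<And>n. \<bar>birkhoff_sum f T n ((g ^^ n) x) - birkhoff_sum f T n ((g ^^ n) y)\<bar> < \<eta>"
    then have near: "\<forall>t. d (susp_flow l f T t (cls (x, 0))) (susp_flow l f T t (cls (y, 0))) < e"
      using \<eta>(2) by blast
    have D0: "(x, 0) \<in> D" "(y, 0) \<in> D"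
      using xy Tpos by (auto simp: susp_domain_def less_imp_le)
    then obtain s where s: "\<bar>s\<bar> < m" "cls (y, 0) = susp_flow l f T s (cls (x, 0))"
      using e(2)[OF _ _ near] by (auto simp: susp_space_def quotientI)
    have "(y, 0) \<in> cls (y, 0)"
      by (rule equiv_class_self[OF equiv_susp_rel D0(2)])
    \<comment> \<open>The flow acts on whole classes, so only some representative \<open>p\<close>
      of the class of \<open>(x, 0)\<close> is known to move to \<open>(y, 0)\<close>; a move of
      time 0 links \<open>(x, 0)\<close> to \<open>p\<close>.\<close>
    then obtain p where p: "(x, 0) \<in> D" "p \<in> cls (x, 0)" "susp_move f T s p (y, 0)"
      using s D0 unfolding susp_flow_def by blast
    then have pD: "p \<in> D" by (auto simp: susp_rel_def)
    then have "susp_move f T 0 (x, 0) p"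
      using susp_move_0_iff[OF f_simps Tpos D0(1)] p by simp
    moreover have "fst p \<in> l" using pD by (auto simp: susp_domain_def)
    ultimately have "susp_move f T (0 + s) (x, 0) (y, 0)"
      using susp_move_trans[OF f_simps, of "(x, 0)" p "(y, 0)" T 0 s] p xy by simp
    then obtain n where "(y = (f ^^ n) x \<and> s = birkhoff_sum f T n x) \<or>
        (x = (f ^^ n) y \<and> s + birkhoff_sum f T n y = 0)"
      by (fastforce simp: susp_move_def)
    \<comment> \<open>By \<open>S\<close>, a nonzero \<open>n\<close> would give
      \<open>\<bar>s\<bar> \<ge> m\<close>; for \<open>n = 0\<close> the base points agree.\<close>
    then show "x = y"
      using S[of x n] S[of y n] xy s(1) by (cases "n = 0") auto
  qed
qed

end

section \<open>Interval homeomorphisms\<close>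

text \<open>An orbit of an increasing self-map of a bounded interval is monotone and bounded, hence
  convergent; its increments have constant sign, so their absolute values telescope.\<close>

lemma summable_funpow_increments:
  fixes h :: "real \<Rightarrow> real"
  assumes h: "mono_on {a..b} h" "h ` {a..b} \<subseteq> {a..b}" and z: "z \<in> {a..b}"
  shows "summable (\<lambda>n. \<bar>(h ^^ n) z - (h ^^ Suc n) z\<bar>)"
proof -
  let ?X = "\<lambda>n. (h ^^ n) z"
  have X: "?X n \<in> {a..b}" for n
    by (rule funpow_closed[OF h(2) z])
  have "monoseq ?X"
  proof (cases "z \<le> h z")
    case True
    have "?X n \<le> ?X (Suc n)" for n
    proof (induction n)
      case (Suc n)
      with monotone_onD[OF h(1) X X, of n "Suc n"] show ?case by simp
    qed (use True in simp)
    then show ?thesis by (simp add: monoseq_Suc)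
  next
    case False
    have "?X (Suc n) \<le> ?X n" for n
    proof (induction n)
      case (Suc n)
      with monotone_onD[OF h(1) X X, of "Suc n" n] show ?case by simp
    qed (use False in simp)
    then show ?thesis by (simp add: monoseq_Suc)
  qed
  moreover have "Bseq ?X"
  proof (rule BseqI')
    show "norm (?X n) \<le> \<bar>a\<bar> + \<bar>b\<bar>" for n using X[of n] by auto
  qed
  ultimately have "convergent ?X"
    by (rule Bseq_monoseq_convergent[rotated])
  then obtain c where c: "?X \<longlonglongrightarrow> c" by (auto simp: convergent_def)
  show ?thesis
  proof (cases "\<forall>n. ?X n \<le> ?X (Suc n)")
    case True
    then have "\<bar>?X n - ?X (Suc n)\<bar> = ?X (Suc n) - ?X n" for n
      by (metis abs_minus_commute abs_of_nonneg diff_ge_0_iff_ge)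
    then show ?thesis using telescope_summable[OF c] by simp
  next
    case False
    then have "?X (Suc n) \<le> ?X n" for n
      using \<open>monoseq ?X\<close> unfolding monoseq_Suc by blast
    then have "\<bar>?X n - ?X (Suc n)\<bar> = ?X n - ?X (Suc n)" for n
      by (simp only: abs_of_nonneg diff_ge_0_iff_ge)
    then show ?thesis using telescope_summable'[OF c] by simp
  qed
qed

lemma homeomorphism_strict_mono_or_antimono:
  fixes f :: "real \<Rightarrow> real"
  assumes "homeomorphism {a..b} {a..b} f g"
  shows "strict_mono_on {a..b} f \<or> strict_antimono_on {a..b} f"
proof -
  have "inj_on f {a..b}" "continuous_on {a..b} f"
    using assms by (auto simp: homeomorphism_def intro: inj_on_inverseI)
  then show ?thesis
    using injective_eq_monotone_map[of "{a..b}" f] by (simp add: is_interval_cc)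
qed

text \<open>Whether \<open>f\<close> increases or decreases, \<open>f \<circ> f\<close> increases.
  The even and odd terms of the series are increments of the orbits of \<open>z\<close> and
  \<open>f z\<close> under \<open>f \<circ> f\<close>.\<close>

lemma summable_two_step_increments:
  fixes f :: "real \<Rightarrow> real"
  assumes f: "homeomorphism {a..b} {a..b} f g" and z: "z \<in> {a..b}"
  shows "summable (\<lambda>n. \<bar>(f ^^ n) z - (f ^^ n) (f (f z))\<bar>)"
proof -
  let ?h = "f \<circ> f"
  have im: "f ` {a..b} \<subseteq> {a..b}" using f by (auto simp: homeomorphism_def)
  have h: "mono_on {a..b} ?h"
    using homeomorphism_strict_mono_or_antimono[OF f]
  proof
    assume "strict_mono_on {a..b} f"
    then have "mono_on {a..b} f" by (rule strict_mono_on_imp_mono_on)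
    then show ?thesis using im unfolding monotone_on_def by (auto simp: image_subset_iff)
  next
    assume "strict_antimono_on {a..b} f"
    then have "antimono_on {a..b} f" by (simp add: strict_antimono_iff_antimono)
    then show ?thesis using im unfolding monotone_on_def by (auto simp: image_subset_iff)
  qed
  have h2: "?h ` {a..b} \<subseteq> {a..b}" using im by auto
  have pow: "(?h ^^ n) x = (f ^^ (2 * n)) x" for n x
    using funpow_mult[of n 2 f] by (simp add: numeral_2_eq_2 mult.commute)
  let ?L = "\<lambda>n. \<bar>(f ^^ n) z - (f ^^ n) (f (f z))\<bar>"
  have "?L (2 * n) = \<bar>(?h ^^ n) z - (?h ^^ Suc n) z\<bar>" for n
    unfolding funpow_Suc_right comp_def[of "?h ^^ n"] pow by simp
  moreover have "?L (2 * n + 1) = \<bar>(?h ^^ n) (f z) - (?h ^^ Suc n) (f z)\<bar>" for n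
    unfolding funpow_Suc_right comp_def[of "?h ^^ n"] pow by (simp add: funpow_swap1)
  ultimately have "summable (\<lambda>n. ?L (2 * n))" "summable (\<lambda>n. ?L (2 * n + 1))"
    using summable_funpow_increments[OF h h2, of z] summable_funpow_increments[OF h h2, of "f z"] z im
    by (simp_all only: image_subset_iff)
  \<comment> \<open>The two summable series are interleaved back into one.\<close>
  from sums_if[OF this(2,1)[THEN summable_sums]]
  have "summable (\<lambda>n. if even n then ?L (2 * (n div 2)) else ?L (2 * ((n - 1) div 2) + 1))"
    by (rule sums_summable)
  also have "(\<lambda>n. if even n then ?L (2 * (n div 2)) else ?L (2 * ((n - 1) div 2) + 1)) = ?L"
    by (rule ext) (auto elim!: oddE)
  finally show ?thesis .
qed

text \<open>Every iterate of a monotone map preserves betweenness. This dominates the orbit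
  distances of intermediate points by those of the endpoint \<open>w\<close>.\<close>

lemma funpow_between:
  fixes f :: "real \<Rightarrow> real"
  assumes f: "homeomorphism {a..b} {a..b} f g"
    and "z \<in> {a..b}" "w \<in> {a..b}" "y \<in> closed_segment z w"
  shows "\<bar>(f ^^ n) z - (f ^^ n) y\<bar> \<le> \<bar>(f ^^ n) z - (f ^^ n) w\<bar>"
proof -
  have im: "f ` {a..b} \<subseteq> {a..b}" using f by (auto simp: homeomorphism_def)
  have y: "y \<in> {a..b}"
    using assms by (auto simp: closed_segment_eq_real_ivl split: if_splits)
  have "(f ^^ n) y \<in> closed_segment ((f ^^ n) z) ((f ^^ n) w)"
  proof (induction n)
    case (Suc n)
    have "(f ^^ n) z \<in> {a..b}" "(f ^^ n) w \<in> {a..b}" "(f ^^ n) y \<in> {a..b}"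
      using funpow_closed[OF im] assms y by blast+
    note in_ab = this
    from homeomorphism_strict_mono_or_antimono[OF f] show ?case
    proof
      assume "strict_mono_on {a..b} f"
      then have "mono_on {a..b} f" by (rule strict_mono_on_imp_mono_on)
      note mono = monotone_onD[OF this]
      from Suc mono[OF in_ab(1,3)] mono[OF in_ab(3,2)] mono[OF in_ab(2,3)] mono[OF in_ab(3,1)]
      show ?thesis by (auto simp: closed_segment_eq_real_ivl split: if_splits)
    next
      assume "strict_antimono_on {a..b} f"
      then have "antimono_on {a..b} f" by (simp add: strict_antimono_iff_antimono)
      note mono = monotone_onD[OF this]
      from Suc mono[OF in_ab(1,3)] mono[OF in_ab(3,2)] mono[OF in_ab(2,3)] mono[OF in_ab(3,1)]
      show ?thesis by (auto simp: closed_segment_eq_real_ivl split: if_splits)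
    qed
  qed (use assms in simp)
  then show ?thesis
    by (auto simp: closed_segment_eq_real_ivl split: if_splits)
qed

lemma continuous_on_funpow:
  assumes "continuous_on S f" "f ` S \<subseteq> S"
  shows "continuous_on S (f ^^ n)"
proof (induction n)
  case (Suc n)
  have "(f ^^ n) ` S \<subseteq> S" using funpow_closed[OF assms(2)] by blast
  with continuous_on_compose2[OF assms(1) Suc] show ?case by (simp add: o_def)
qed (simp add: id_def)

text \<open>By domination and the Weierstrass test, the total orbit distance from \<open>z\<close>
  is a continuous function of \<open>y\<close>. It vanishes at \<open>y = z\<close>, and it bounds
  all partial sums, so \<open>r\<close> does not depend on \<open>n\<close>.\<close>

lemma small_orbit_distance:
  fixes f :: "real \<Rightarrow> real"
  assumes f: "homeomorphism {a..b} {a..b} f g" and zw: "z \<in> {a..b}" "w \<in> {a..b}"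
    and summable: "summable (\<lambda>n. \<bar>(f ^^ n) z - (f ^^ n) w\<bar>)" and "0 < e"
  obtains r where "0 < r"
    "\<And>y n. y \<in> closed_segment z w \<Longrightarrow> \<bar>y - z\<bar> < r \<Longrightarrow> (\<Sum>k<n. \<bar>(f ^^ k) z - (f ^^ k) y\<bar>) < e"
proof -
  let ?J = "closed_segment z w" and ?c = "\<lambda>k y. \<bar>(f ^^ k) z - (f ^^ k) y\<bar>"
  have J: "?J \<subseteq> {a..b}"
    using zw by (auto simp: closed_segment_eq_real_ivl split: if_splits)
  have fc: "continuous_on {a..b} f" "f ` {a..b} \<subseteq> {a..b}"
    using f by (auto simp: homeomorphism_def)
  have bound: "norm (?c k y) \<le> \<bar>(f ^^ k) z - (f ^^ k) w\<bar>" if "y \<in> ?J" for k y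
    using funpow_between[OF f zw that] by simp
  have "uniform_limit ?J (\<lambda>n y. \<Sum>k<n. ?c k y) (\<lambda>y. \<Sum>k. ?c k y) sequentially"
    by (rule Weierstrass_m_test[OF bound summable])
  moreover have "continuous_on ?J (\<lambda>y. \<Sum>k<n. ?c k y)" for n
    by (intro continuous_intros continuous_on_subset[OF continuous_on_funpow[OF fc] J])
  ultimately have "continuous_on ?J (\<lambda>y. \<Sum>k. ?c k y)"
    by (intro uniform_limit_theorem[where F = sequentially]) auto
  then obtain r where r: "0 < r"
    "\<And>y. y \<in> ?J \<Longrightarrow> dist y z < r \<Longrightarrow> dist (\<Sum>k. ?c k y) (\<Sum>k. ?c k z) < e"
    unfolding continuous_on_iff using \<open>0 < e\<close> ends_in_segment(1)[of z w] by blast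
  show thesis
  proof (rule that[OF r(1)])
    fix y n assume y: "y \<in> ?J" "\<bar>y - z\<bar> < r"
    have "summable (\<lambda>k. ?c k y)"
      by (rule summable_comparison_test'[OF summable, of 0]) (rule bound[OF y(1)])
    then have "(\<Sum>k<n. ?c k y) \<le> (\<Sum>k. ?c k y)"
      by (intro sum_le_suminf) auto
    also have "\<dots> < e"
      using r(2)[OF y(1)] y(2) by (simp add: dist_real_def)
    finally show "(\<Sum>k<n. ?c k y) < e" .
  qed
qed

section \<open>Lipschitz bounds and injectivity on an interval\<close>

lemma C1_on_imp_lipschitz:
  assumes "C1_on {a..b} T"
  obtains K where "0 < K" "\<And>x y. x \<in> {a..b} \<Longrightarrow> y \<in> {a..b} \<Longrightarrow> \<bar>T x - T y\<bar> \<le> K * \<bar>x - y\<bar>"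
proof -
  obtain T' where T': "\<And>x. x \<in> {a..b} \<Longrightarrow> (T has_real_derivative T' x) (at x within {a..b})"
    and cont: "continuous_on {a..b} T'"
    using assms unfolding C1_on_def by blast
  have "bounded (T' ` {a..b})"
    by (intro compact_imp_bounded compact_continuous_image cont) simp
  then obtain K where "0 < K" "\<And>x. x \<in> {a..b} \<Longrightarrow> norm (T' x) \<le> K"
    unfolding bounded_pos by auto
  with field_differentiable_bound[of "{a..b}" T T' K] T' that show thesis
    by (simp add: real_norm_def)
qed

text \<open>If \<open>T\<close> took equal values at \<open>u < v\<close>, it would have an interior
  extremum on \<open>{u..v}\<close> or be constant there. Near an interior extremum, the
  intermediate value theorem yields close points on both sides with equal values.\<close>

lemma locally_injective_imp_inj_on:
  fixes T :: "real \<Rightarrow> real"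
  assumes cont: "continuous_on {a..b} T" and "0 < \<eta>"
    and inj: "\<And>x y. x \<in> {a..b} \<Longrightarrow> y \<in> {a..b} \<Longrightarrow> \<bar>x - y\<bar> < \<eta> \<Longrightarrow> T x = T y \<Longrightarrow> x = y"
  shows "inj_on T {a..b}"
proof -
  \<comment> \<open>The function \<open>S\<close> carries its own injectivity assumption, so that
    applying this to the negative of \<open>T\<close> excludes interior minima.\<close>
  have no_max: False
    if m: "u < m" "m < v" "{u..v} \<subseteq> {a..b}" and cont: "continuous_on {a..b} S"
      and max: "\<And>x. x \<in> {u..v} \<Longrightarrow> S x \<le> S m"
      and inj: "\<And>x y. x \<in> {a..b} \<Longrightarrow> y \<in> {a..b} \<Longrightarrow> \<bar>x - y\<bar> < \<eta> \<Longrightarrow> S x = S y \<Longrightarrow> x = y"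
    for u m v and S :: "real \<Rightarrow> real"
  proof -
    \<comment> \<open>Steps of \<open>\<eta> / 3\<close> keep \<open>x\<close> and \<open>y\<close>
      less than \<open>\<eta>\<close> apart, within reach of local injectivity.\<close>
    define x where "x = max u (m - \<eta> / 3)"
    define y where "y = min v (m + \<eta> / 3)"
    have xy: "u \<le> x" "x < m" "m < y" "y \<le> v" "y - x < \<eta>"
      using m \<open>0 < \<eta>\<close> by (auto simp: x_def y_def)
    have sub: "{x..m} \<subseteq> {a..b}" "{m..y} \<subseteq> {a..b}" using m xy by fastforce+
    \<comment> \<open>The larger of the two outer values is attained on both sides of
      \<open>m\<close>. Local injectivity merges the two preimages into \<open>m\<close>, so
      \<open>S m\<close> equals \<open>S x\<close> or \<open>S y\<close>, which local injectivity
      forbids.\<close>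
    define c where "c = max (S x) (S y)"
    have c: "S x \<le> c" "S y \<le> c" "c \<le> S m"
      using max[of x] max[of y] xy by (auto simp: c_def)
    obtain p where p: "x \<le> p" "p \<le> m" "S p = c"
      using IVT'[of S x c m] c xy continuous_on_subset[OF cont sub(1)] by auto
    obtain q where q: "m \<le> q" "q \<le> y" "S q = c"
      using IVT2'[of S y c m] c xy continuous_on_subset[OF cont sub(2)] by auto
    have in_ab: "t \<in> {a..b}" if "x \<le> t" "t \<le> y" for t
      using that xy m(3) by (auto simp: subset_iff)
    have "p = q" by (rule inj) (use p q xy in_ab in auto)
    then have "S m = c" using p q by (metis order_antisym)
    moreover have "S x = c \<or> S y = c" by (auto simp: c_def)
    moreover have "S x \<noteq> S m" "S y \<noteq> S m"
      using inj[OF in_ab in_ab, of x m] inj[OF in_ab in_ab, of y m] xy by (auto simp: abs_if)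
    ultimately show False by auto
  qed
  have *: False if uv: "u \<in> {a..b}" "v \<in> {a..b}" "u < v" "T u = T v" for u v
  proof -
    have sub: "{u..v} \<subseteq> {a..b}" using uv by auto
    then have c: "continuous_on {u..v} T" by (rule continuous_on_subset[OF cont])
    obtain p where p: "p \<in> {u..v}" "\<And>x. x \<in> {u..v} \<Longrightarrow> T x \<le> T p"
      using continuous_attains_sup[OF _ _ c] uv by auto
    obtain q where q: "q \<in> {u..v}" "\<And>x. x \<in> {u..v} \<Longrightarrow> T q \<le> T x"
      using continuous_attains_inf[OF _ _ c] uv by auto
    consider "u < p" "p < v" | "u < q" "q < v" | "p \<in> {u, v}" "q \<in> {u, v}"
      using p q by fastforce
    then show False
    proof cases
      case 1
      then show False using no_max[OF _ _ sub cont p(2) inj] by blast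
    next
      case 2
      have "x = y" if "x \<in> {a..b}" "y \<in> {a..b}" "\<bar>x - y\<bar> < \<eta>" "- T x = - T y" for x y
        by (rule inj) (use that in auto)
      from no_max[OF 2 sub continuous_on_minus[OF cont] _ this] q(2) show False by simp
    next
      case 3
      \<comment> \<open>Both extrema lie at endpoints, where \<open>T\<close> takes the same value;
        so \<open>T\<close> is constant on \<open>{u..v}\<close> and the midpoint serves as an
        interior maximum.\<close>
      then have "T q = T p" using uv(4) by auto
      then have max: "T x \<le> T ((u + v) / 2)" if "x \<in> {u..v}" for x
        using p(2)[OF that] q(2)[of "(u + v) / 2"] uv(3) by simp
      show False
        by (rule no_max[OF _ _ sub cont max inj]) (use uv(3) in auto)
    qed
  qed
  then show ?thesis
    by (metis inj_onI linorder_neqE_linordered_idom)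
qed

section \<open>Expansive suspensions over an interval\<close>

locale interval_suspension = metrized_suspension "{a..b}" f g T d
  for a b :: real and f g T :: "real \<Rightarrow> real" and d +
  assumes expansive: "kinematic_expansive (susp_space {a..b} f T) d (susp_flow {a..b} f T)"
begin

text \<open>Reversing the order of summation expresses backward Birkhoff sums along the orbit of
  \<open>g\<close>, so that the distance estimates for \<open>g\<close> apply to them.\<close>

lemma birkhoff_sum_inverse:
  assumes "x \<in> {a..b}"
  shows "birkhoff_sum f T n ((g ^^ n) x) = (\<Sum>k<n. T ((g ^^ Suc k) x))"
proof (induction n)
  case (Suc n)
  have gn: "(g ^^ n) x \<in> {a..b}" using funpow_in assms by blast
  have "birkhoff_sum f T (1 + n) ((g ^^ Suc n) x) =
      T ((g ^^ Suc n) x) + birkhoff_sum f T n (f (g ((g ^^ n) x)))"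
    unfolding birkhoff_sum_add by (simp add: birkhoff_sum_def)
  then show ?case using Suc f_g[OF gn] by simp
qed simp

text \<open>A nondegenerate interval between \<open>z\<close> and \<open>f (f z)\<close> is wandering for \<open>f \<circ> f\<close>, so its
  images under all iterates have finite total length; a Lipschitz \<open>T\<close> turns this into uniformly
  small differences of Birkhoff sums.\<close>

lemma f_f_eq:
  assumes T: "0 < K" "\<And>x y. x \<in> {a..b} \<Longrightarrow> y \<in> {a..b} \<Longrightarrow> \<bar>T x - T y\<bar> \<le> K * \<bar>x - y\<bar>"
    and z: "z \<in> {a..b}"
  shows "f (f z) = z"
proof (rule ccontr)
  assume neq: "f (f z) \<noteq> z"
  define w where "w = f (f z)"
  have w: "w \<in> {a..b}" "w \<noteq> z" using neq z f_in by (auto simp: w_def)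
  obtain \<eta> where \<eta>: "0 < \<eta>"
    "\<And>x y. \<lbrakk>x \<in> {a..b}; y \<in> {a..b};
       \<And>n. dist ((f ^^ n) x) ((f ^^ n) y) < \<eta>; \<And>n. dist ((g ^^ n) x) ((g ^^ n) y) < \<eta>;
       \<And>n. \<bar>birkhoff_sum f T n x - birkhoff_sum f T n y\<bar> < \<eta>;
       \<And>n. \<bar>birkhoff_sum f T n ((g ^^ n) x) - birkhoff_sum f T n ((g ^^ n) y)\<bar> < \<eta>\<rbrakk> \<Longrightarrow>
       x = y"
    using kinematic_expansive_imp_eq[OF expansive] by metis
  \<comment> \<open>The bound \<open>\<eta>\<close> serves the orbit distances, and
    \<open>\<eta> / K\<close> serves the Birkhoff sums through the Lipschitz estimate.\<close>
  define e where "e = min \<eta> (\<eta> / K)"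
  have e: "0 < e" "e \<le> \<eta>" "K * e \<le> \<eta>"
    using \<eta>(1) T(1) by (auto simp: e_def min_def field_simps)
  have sf: "summable (\<lambda>n. \<bar>(f ^^ n) z - (f ^^ n) w\<bar>)"
    unfolding w_def by (rule summable_two_step_increments[OF homeo z])
  \<comment> \<open>Under \<open>g\<close> the roles are exchanged: the two-step increments start at
    \<open>w\<close> and lead to \<open>z\<close>.\<close>
  have "g (g w) = z" unfolding w_def using g_f z f_in by simp
  then have sg: "summable (\<lambda>n. \<bar>(g ^^ n) z - (g ^^ n) w\<bar>)"
    using summable_two_step_increments[OF homeomorphism_symD[OF homeo] w(1)]
    by (simp add: abs_minus_commute)
  obtain r1 where r1: "0 < r1" "\<And>y n. y \<in> closed_segment z w \<Longrightarrow> \<bar>y - z\<bar> < r1 \<Longrightarrow>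
      (\<Sum>k<n. \<bar>(f ^^ k) z - (f ^^ k) y\<bar>) < e"
    using small_orbit_distance[OF homeo z w(1) sf e(1)] by metis
  obtain r2 where r2: "0 < r2" "\<And>y n. y \<in> closed_segment z w \<Longrightarrow> \<bar>y - z\<bar> < r2 \<Longrightarrow>
      (\<Sum>k<n. \<bar>(g ^^ k) z - (g ^^ k) y\<bar>) < e"
    using small_orbit_distance[OF homeomorphism_symD[OF homeo] z w(1) sg e(1)] by metis
  define r where "r = min r1 r2 / 2"
  \<comment> \<open>The point \<open>y\<close> is \<open>z\<close> shifted by \<open>r\<close>
    towards \<open>w\<close>, stopping at \<open>w\<close>; the halving in \<open>r\<close> makes
    both radius conditions strict.\<close>
  define y where "y = (if z < w then min w (z + r) else max w (z - r))"
  have y: "y \<in> closed_segment z w" "\<bar>y - z\<bar> < r1" "\<bar>y - z\<bar> < r2" "y \<noteq> z"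
    using r1(1) r2(1) w(2)
    by (auto simp: y_def r_def closed_segment_eq_real_ivl min_def max_def split: if_splits)
  then have yab: "y \<in> {a..b}"
    using z w by (auto simp: closed_segment_eq_real_ivl split: if_splits)
  note F = r1(2)[OF y(1,2)] and G = r2(2)[OF y(1,3)]
  have single: "c n < e" if "\<And>n. (\<Sum>k<n. c k) < e" "\<And>n. 0 \<le> c n" for c :: "nat \<Rightarrow> real" and n
    using that(1)[of "Suc n"] sum_nonneg[of "{..<n}" c] that(2) by simp
  have birk: "\<bar>(\<Sum>k<n. T (p k)) - (\<Sum>k<n. T (q k))\<bar> < \<eta>"
    if "(\<Sum>k<n. \<bar>p k - q k\<bar>) < e" "\<And>k. p k \<in> {a..b}" "\<And>k. q k \<in> {a..b}" for p q n
  proof -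
    have "\<bar>(\<Sum>k<n. T (p k)) - (\<Sum>k<n. T (q k))\<bar> \<le> (\<Sum>k<n. K * \<bar>p k - q k\<bar>)"
      unfolding sum_subtractf[symmetric]
      by (rule order_trans[OF sum_abs]) (intro sum_mono T(2) that)
    also have "\<dots> < K * e"
      using that(1) T(1) by (simp add: sum_distrib_left[symmetric])
    finally show ?thesis using e(3) by simp
  qed
  have "z = y"
  proof (rule \<eta>(2)[OF z yab])
    fix n
    show "dist ((f ^^ n) z) ((f ^^ n) y) < \<eta>"
      using single[OF F, of n] e by (simp add: dist_real_def)
    show "dist ((g ^^ n) z) ((g ^^ n) y) < \<eta>"
      using single[OF G, of n] e by (simp add: dist_real_def)
    show "\<bar>birkhoff_sum f T n z - birkhoff_sum f T n y\<bar> < \<eta>"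
      unfolding birkhoff_sum_def using funpow_in z yab by (intro birk F) blast+
    \<comment> \<open>Backward sums start at the first iterate of \<open>g\<close>; adding the
      nonnegative zeroth term brings them into the form bounded by \<open>G\<close>.\<close>
    have "(\<Sum>k<n. \<bar>(g ^^ Suc k) z - (g ^^ Suc k) y\<bar>) \<le> (\<Sum>k<Suc n. \<bar>(g ^^ k) z - (g ^^ k) y\<bar>)"
      unfolding sum.lessThan_Suc_shift by simp
    also have "\<dots> < e" by (rule G)
    finally show "\<bar>birkhoff_sum f T n ((g ^^ n) z) - birkhoff_sum f T n ((g ^^ n) y)\<bar> < \<eta>"
      unfolding birkhoff_sum_inverse[OF z] birkhoff_sum_inverse[OF yab]
      using funpow_in z yab by (intro birk) blast+
  qed
  with y(4) show False by simp
qed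

text \<open>If \<open>f\<close> reverses the interval, then \<open>x\<close> and \<open>f x\<close> shadow each other for \<open>x\<close> near the fixed
  point, since the difference of their Birkhoff sums telescopes.\<close>

lemma f_eq:
  assumes ff: "\<And>x. x \<in> {a..b} \<Longrightarrow> f (f x) = x" and x: "x \<in> {a..b}"
  shows "f x = x"
  using homeomorphism_strict_mono_or_antimono[OF homeo]
proof
  assume "strict_mono_on {a..b} f"
  \<comment> \<open>An increasing involution fixes every point: \<open>x < f x\<close> would give
    \<open>f x < f (f x) = x\<close>, and symmetrically for \<open>f x < x\<close>.\<close>
  then show ?thesis
    using monotone_onD[of "{a..b}" "(<)" "(<)" f x "f x"]
      monotone_onD[of "{a..b}" "(<)" "(<)" f "f x" x] ff x f_in[OF x] by fastforce
next
  assume anti: "strict_antimono_on {a..b} f"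
  have fc: "continuous_on {a..b} f" using homeo by (simp add: homeomorphism_def)
  obtain \<eta> where \<eta>: "0 < \<eta>"
    "\<And>x y. \<lbrakk>x \<in> {a..b}; y \<in> {a..b};
       \<And>n. dist ((f ^^ n) x) ((f ^^ n) y) < \<eta>; \<And>n. dist ((g ^^ n) x) ((g ^^ n) y) < \<eta>;
       \<And>n. \<bar>birkhoff_sum f T n x - birkhoff_sum f T n y\<bar> < \<eta>;
       \<And>n. \<bar>birkhoff_sum f T n ((g ^^ n) x) - birkhoff_sum f T n ((g ^^ n) y)\<bar> < \<eta>\<rbrakk> \<Longrightarrow>
       x = y"
    using kinematic_expansive_imp_eq[OF expansive] by metis
  \<comment> \<open>Both orbits stay in the pair \<open>{y, f y}\<close>, so closeness of these two
    points and of their return times controls all times.\<close>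
  have fixed: "f y = y"
    if y: "y \<in> {a..b}" and near: "\<bar>y - f y\<bar> < \<eta>" "\<bar>T y - T (f y)\<bar> < \<eta>" for y
  proof -
    have g_eq: "g u = f u" if "u \<in> {a..b}" for u
      using g_f[of "f u"] ff[OF that] f_in[OF that] by simp
    have fn: "(f ^^ n) u \<in> {y, f y}" if "u \<in> {y, f y}" for n u
      using that ff[OF y] by (induction n) auto
    have gn: "(g ^^ n) u \<in> {y, f y}" if "u \<in> {y, f y}" for n u
      using that ff[OF y] g_eq[OF y] g_eq[OF f_in[OF y]] by (induction n) auto
    have g_commute: "(g ^^ n) (f y) = f ((g ^^ n) y)" for n
    proof (induction n)
      case (Suc n)
      have "(g ^^ n) y \<in> {a..b}" using funpow_in y by blast
      then show ?case using Suc f_g g_f by simp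
    qed simp
    \<comment> \<open>The orbit of \<open>f u\<close> is the orbit of \<open>u\<close> shifted by
      one, so only the two end terms survive.\<close>
    have birk: "birkhoff_sum f T n u - birkhoff_sum f T n (f u) = T u - T ((f ^^ n) u)" for n u
      by (induction n) (auto simp: birkhoff_sum_def funpow_swap1)
    have T: "\<bar>T u - T v\<bar> < \<eta>" if "u \<in> {y, f y}" "v \<in> {y, f y}" for u v
      using that near(2) \<eta>(1) by (auto simp: abs_minus_commute)
    have dist: "dist u v < \<eta>" if "u \<in> {y, f y}" "v \<in> {y, f y}" for u v
      using that near(1) \<eta>(1) by (auto simp: abs_minus_commute dist_real_def)
    have "y = f y"
    proof (rule \<eta>(2)[OF y f_in[OF y]])
      fix n
      show "dist ((f ^^ n) y) ((f ^^ n) (f y)) < \<eta>" "dist ((g ^^ n) y) ((g ^^ n) (f y)) < \<eta>"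
        by (intro dist fn gn; simp)+
      show "\<bar>birkhoff_sum f T n y - birkhoff_sum f T n (f y)\<bar> < \<eta>"
        unfolding birk by (intro T fn) auto
      show "\<bar>birkhoff_sum f T n ((g ^^ n) y) - birkhoff_sum f T n ((g ^^ n) (f y))\<bar> < \<eta>"
        unfolding g_commute birk by (intro T fn gn) auto
    qed
    then show ?thesis by simp
  qed
  have ab: "a \<le> b" using x by auto
  obtain c where c: "c \<in> {a..b}" "f c = c"
  proof -
    have "f a \<in> {a..b}" "f b \<in> {a..b}" using f_in ab by auto
    then have "\<exists>c. a \<le> c \<and> c \<le> b \<and> f c - c = 0"
      using ab by (intro IVT2' continuous_intros fc) auto
    then show thesis using that by auto
  qed
  \<comment> \<open>A strictly decreasing map has at most one fixed point.\<close>
  have unique: "y = c" if "y \<in> {a..b}" "f y = y" for y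
    using monotone_onD[OF anti, of y c] monotone_onD[OF anti, of c y] c that by fastforce
  have Tfc: "continuous_on {a..b} (\<lambda>y. T (f y))"
    by (rule continuous_on_compose2[OF Tc fc]) (use f_in in auto)
  obtain r1 where r1: "0 < r1" "\<And>y. y \<in> {a..b} \<Longrightarrow> dist y c < r1 \<Longrightarrow> \<bar>y - f y\<bar> < \<eta>"
  proof -
    have "continuous_on {a..b} (\<lambda>y. y - f y)" by (intro continuous_intros fc)
    then obtain r where "0 < r"
      "\<And>y. y \<in> {a..b} \<Longrightarrow> dist y c < r \<Longrightarrow> dist (y - f y) (c - f c) < \<eta>"
      unfolding continuous_on_iff using c(1) \<eta>(1) by blast
    with c(2) show thesis by (intro that) (auto simp: dist_real_def)
  qed
  obtain r2 where r2: "0 < r2" "\<And>y. y \<in> {a..b} \<Longrightarrow> dist y c < r2 \<Longrightarrow> \<bar>T y - T (f y)\<bar> < \<eta>"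
  proof -
    have "continuous_on {a..b} (\<lambda>y. T y - T (f y))" by (intro continuous_intros Tc Tfc)
    then obtain r where "0 < r"
      "\<And>y. y \<in> {a..b} \<Longrightarrow> dist y c < r \<Longrightarrow> dist (T y - T (f y)) (T c - T (f c)) < \<eta>"
      unfolding continuous_on_iff using c(1) \<eta>(1) by blast
    with c(2) show thesis by (intro that) (auto simp: dist_real_def)
  qed
  have near_c: "y = c" if "y \<in> {a..b}" "dist y c < min r1 r2" for y
  proof -
    have "dist y c < r1" "dist y c < r2" using that(2) by simp_all
    then have "f y = y" using fixed[OF that(1)] r1(2) r2(2) that(1) by blast
    then show ?thesis by (rule unique[OF that(1)])
  qed
  \<comment> \<open>All points near \<open>c\<close> are fixed and hence equal to \<open>c\<close>;
    a point \<open>x \<noteq> c\<close> would supply others between it and \<open>c\<close>. The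
    decreasing case thus survives only on a one-point interval.\<close>
  have "x = c"
  proof (rule ccontr)
    assume "x \<noteq> c"
    define r where "r = min r1 r2 / 2"
    define y where "y = (if c < x then min x (c + r) else max x (c - r))"
    have "y \<in> {a..b}" "dist y c < min r1 r2" "y \<noteq> c"
      using \<open>x \<noteq> c\<close> r1(1) r2(1) x c(1)
      by (auto simp: y_def r_def dist_real_def min_def max_def split: if_splits)
    then show False using near_c by blast
  qed
  with c show ?thesis by simp
qed

text \<open>For the identity, the Birkhoff sums are multiples \<open>n * T x\<close>. Equal return
  times make all their differences vanish, so expansivity separates only points at distance at least
  \<open>\<eta>\<close>: \<open>T\<close> is locally injective.\<close>

lemma inj_on_return_time:
  assumes id: "\<And>x. x \<in> {a..b} \<Longrightarrow> f x = x"
  shows "inj_on T {a..b}"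
proof -
  obtain \<eta> where \<eta>: "0 < \<eta>"
    "\<And>x y. \<lbrakk>x \<in> {a..b}; y \<in> {a..b};
       \<And>n. dist ((f ^^ n) x) ((f ^^ n) y) < \<eta>; \<And>n. dist ((g ^^ n) x) ((g ^^ n) y) < \<eta>;
       \<And>n. \<bar>birkhoff_sum f T n x - birkhoff_sum f T n y\<bar> < \<eta>;
       \<And>n. \<bar>birkhoff_sum f T n ((g ^^ n) x) - birkhoff_sum f T n ((g ^^ n) y)\<bar> < \<eta>\<rbrakk> \<Longrightarrow>
       x = y"
    using kinematic_expansive_imp_eq[OF expansive] by metis
  have fn: "(f ^^ n) x = x" if "x \<in> {a..b}" for n x
    using that id by (induction n) auto
  have gn: "(g ^^ n) x = x" if "x \<in> {a..b}" for n x
    using funpow_g_f[OF that, of n] fn[OF that] by simp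
  have birk: "birkhoff_sum f T n x = real n * T x" if "x \<in> {a..b}" for n x
    using fn[OF that] by (simp add: birkhoff_sum_def)
  show ?thesis
  proof (rule locally_injective_imp_inj_on[OF Tc \<eta>(1)])
    fix x y assume "x \<in> {a..b}" "y \<in> {a..b}" "\<bar>x - y\<bar> < \<eta>" "T x = T y"
    with \<eta>(1) show "x = y"
      by (intro \<eta>(2)) (simp_all add: fn gn birk dist_real_def del: atLeastAtMost_iff)
  qed
qed

end

theorem proposition4p8:
  fixes a b :: real and f g T :: "real \<Rightarrow> real"
    and d :: "(real \<times> real) set \<Rightarrow> (real \<times> real) set \<Rightarrow> real"
  assumes "a \<le> b"
    and "homeomorphism {a..b} {a..b} f g"
    and "\<And>x. x \<in> {a..b} \<Longrightarrow> 0 < T x"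
    and "C1_on {a..b} T"
    and "Metric_space (susp_space {a..b} f T) d"
    and "Metric_space.mtopology (susp_space {a..b} f T) d = susp_topology {a..b} f T"
    and "kinematic_expansive (susp_space {a..b} f T) d (susp_flow {a..b} f T)"
  shows "(\<forall>x\<in>{a..b}. f x = x) \<and> (strict_mono_on {a..b} T \<or> strict_antimono_on {a..b} T)"
proof -
  have Tc: "continuous_on {a..b} T"
    using assms(4) by (auto simp: C1_on_def intro: DERIV_continuous_on)
  interpret interval_suspension a b f g T d
    by (intro interval_suspension.intro metrized_suspension.intro interval_suspension_axioms.intro)
      (use assms Tc in auto)
  obtain K where K: "0 < K" "\<And>x y. x \<in> {a..b} \<Longrightarrow> y \<in> {a..b} \<Longrightarrow> \<bar>T x - T y\<bar> \<le> K * \<bar>x - y\<bar>"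
    using C1_on_imp_lipschitz[OF assms(4)] by metis
  have id: "f x = x" if "x \<in> {a..b}" for x
    using f_eq[OF f_f_eq[OF K] that] .
  moreover have "strict_mono_on {a..b} T \<or> strict_antimono_on {a..b} T"
    using injective_eq_monotone_map[of "{a..b}" T] inj_on_return_time[OF id] Tc
    by (simp add: is_interval_cc)
  ultimately show ?thesis by blast
qed

end
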